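(* Let $k\ge 1$ and let $\widehat{\mathcal{A}}=(\mathcal{A}_0,\mathcal{A}_1,\dots,\mathcal{A}_k)$ be a tuple of tensors in $\mathbb{T}(m,n)$ which is an $\mathbb{EHR}_0$ tensor and satisfies $\deg(\widehat{\mathcal{A}})\neq 0$. Then the solution set $\mathrm{SOL}(\widehat{\mathcal{A}},\widehat{\mathbf d},q)$ is nonempty and compact for every tuple $\widehat{\mathbf d}=(d_1,\dots,d_{k-1})$ of vectors in $\mathbb{R}^n_{++}$ and every $q\in\mathbb{R}^n$.
   Context: Let $m\ge 2$, $n\ge 1$ be integers. $\mathbb{T}(m,n)$ is the set of real tensors $\mathcal{A}=(a_{i_1\dots i_m})$ of order $m$ and dimension $n$ ($i_1,\dots,i_m\in\{1,\dots,n\}$; no symmetry assumed). For $x\in\mathbb{R}^n$, $\mathcal{A}x^{m-1}\in\mathbb{R}^n$ is defined by $(\mathcal{A}x^{m-1})_i=\sum_{i_2,\dots,i_m=1}^n a_{ii_2\dots i_m}x_{i_2}\cdots x_{i_m}$. $x\wedge y$ is the componentwise minimum. $\mathbb{R}^n_{++}$ is the set of vectors with all components $>0$. Write $[k]=\{1,\dots,k\}$. $\mathrm{SOL}(\widehat{\mathcal{A}},\widehat{\mathbf d},q)$ is the set of $(x_0,x_1,\dots,x_k)\in(\mathbb{R}^n)^{k+1}$ such that $\mathcal{A}_0x_0^{m-1}=q+\sum_{j=1}^k\mathcal{A}_jx_j^{m-1}$, $x_0\wedge x_1=0$, and $(d_j-x_j)\wedge x_{j+1}=0$ for $j\in[k-1]$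 (if $k=1$, $\widehat{\mathbf d}$ is the empty tuple and the last conditions are void). $\widehat{\mathcal{A}}$ is an $\mathbb{EHR}_0$ tensor if the only $(x_0,\dots,x_k)\in(\mathbb{R}^n)^{k+1}$ with $\mathcal{A}_0x_0^{m-1}=\sum_{j=1}^k\mathcal{A}_jx_j^{m-1}$ and $x_0\wedge x_i=0$ for all $i\in[k]$ is $x_0=x_1=\dots=x_k=0$. Define $\Psi_{\widehat{\mathcal{A}}}:(\mathbb{R}^n)^{k+1}\to(\mathbb{R}^n)^{k+1}$ by $\Psi_{\widehat{\mathcal{A}}}(x_0,\dots,x_k)=\big(x_0\wedge x_1,\;x_0\wedge x_2,\dots,x_0\wedge x_k,\;\mathcal{A}_0x_0^{m-1}-\sum_{j=1}^k\mathcal{A}_jx_j^{m-1}\big)$. If $\widehat{\mathcal{A}}$ is an $\mathbb{EHR}_0$ tensor, the only zero of $\Psi_{\widehat{\mathcal{A}}}$ is the zero vector, and $\deg(\widehat{\mathcal{A}})$ denotes the Brouwer degree $\deg(\Psi_{\widehat{\mathcal{A}}},\Omega,\mathbf 0)$, where $\Omega$ is any bounded open set containing the zero vector (the value is independent of $\Omega$). *)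

theory Defs
  imports "HOL-Analysis.Analysis" "HOL-Homology.Homology"
begin

section \<open>Brouwer degree of a map on a bounded open subset of Euclidean space\<close>

text \<open>
  Following \<^const>\<open>Euclidean_space\<close> and \<^const>\<open>nsphere\<close>, a point of $R^N$ is a function on the
  naturals that vanishes from \<open>N\<close> on, and the unit sphere $S^N$ lies in $R^{N+1}$.  Thus $S^N$
  is the one-point compactification of $R^N$, with the north pole as the point at infinity.
\<close>

definition eucl_norm :: "nat \<Rightarrow> (nat \<Rightarrow> real) \<Rightarrow> real" where
  "eucl_norm N v = L2_set v {..<N}"

text \<open>
  The predicate \<^const>\<open>bounded\<close> is of no use here: the metric of the library on functions
  \<^typ>\<open>nat \<Rightarrow> real\<close> is itself bounded.
\<close>

definition eucl_bounded :: "nat \<Rightarrow> (nat \<Rightarrow> real) set \<Rightarrow> bool" where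
  "eucl_bounded N S \<longleftrightarrow> (\<exists>B. \<forall>v\<in>S. eucl_norm N v \<le> B)"

definition north_pole :: "nat \<Rightarrow> nat \<Rightarrow> real" where
  "north_pole N = (\<lambda>i. if i = N then 1 else 0)"

definition stereo :: "nat \<Rightarrow> (nat \<Rightarrow> real) \<Rightarrow> nat \<Rightarrow> real" where
  "stereo N u = (\<lambda>i. if i < N then u i / (1 - u N) else 0)"

definition inv_stereo :: "nat \<Rightarrow> (nat \<Rightarrow> real) \<Rightarrow> nat \<Rightarrow> real" where
  "inv_stereo N v =
     (\<lambda>i. if i < N then 2 * v i / ((eucl_norm N v)\<^sup>2 + 1)
          else if i = N then ((eucl_norm N v)\<^sup>2 - 1) / ((eucl_norm N v)\<^sup>2 + 1)
          else 0)"

text \<open>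
  The map $R^N \to S^N$ that sends the open ball of radius \<open>r\<close> about the origin radially and
  homeomorphically onto the complement of the pole, and everything else to the pole.
\<close>

definition collapse :: "nat \<Rightarrow> real \<Rightarrow> (nat \<Rightarrow> real) \<Rightarrow> nat \<Rightarrow> real" where
  "collapse N r w =
     (if eucl_norm N w < r then inv_stereo N (\<lambda>i. w i / (r - eucl_norm N w)) else north_pole N)"

text \<open>
  Let \<open>\<Omega>\<close> be bounded and open, \<open>f\<close> continuous on its closure, and \<open>f x \<noteq> y\<close> on its frontier.
  The degree $\deg(f,\Omega,y)$ is defined homologically (as in Dold's Lectures on Algebraic
  Topology) as the integer \<open>d\<close> such that the composite
  $$H_N(S^N) \to H_N(S^N, S^N \setminus f^{-1}(y)) \cong H_N(\Omega, \Omega \setminus f^{-1}(y))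
    \to H_N(R^N, R^N \setminus y) \cong H_N(S^N)$$
  is multiplication by \<open>d\<close>.  This composite is induced by a self-map of $S^N$: choose \<open>r > 0\<close>
  with $|f(x) - y| \ge r$ on the frontier, send \<open>x \<in> \<Omega>\<close> to the collapse of $f(x) - y$ with
  radius \<open>r\<close>, and send all other points to the pole.  The choice of \<open>r\<close> is immaterial up to homotopy.
\<close>

definition degree_map ::
  "nat \<Rightarrow> ((nat \<Rightarrow> real) \<Rightarrow> nat \<Rightarrow> real) \<Rightarrow> (nat \<Rightarrow> real) set \<Rightarrow> (nat \<Rightarrow> real) \<Rightarrow> real
     \<Rightarrow> (nat \<Rightarrow> real) \<Rightarrow> nat \<Rightarrow> real" where
  "degree_map N f \<Omega> y r u =
     (if u \<noteq> north_pole N \<and> stereo N u \<in> \<Omega>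
      then collapse N r (\<lambda>i. f (stereo N u) i - y i) else north_pole N)"

definition brouwer_degree ::
  "nat \<Rightarrow> ((nat \<Rightarrow> real) \<Rightarrow> nat \<Rightarrow> real) \<Rightarrow> (nat \<Rightarrow> real) set \<Rightarrow> (nat \<Rightarrow> real) \<Rightarrow> int" where
  "brouwer_degree N f \<Omega> y =
     Brouwer_degree2 N (degree_map N f \<Omega> y
       (SOME r. 0 < r \<and>
          (\<forall>x \<in> Euclidean_space N frontier_of \<Omega>. r \<le> eucl_norm N (\<lambda>i. f x i - y i))))"


section \<open>Tensors and the extended horizontal complementarity problem\<close>

text \<open>
  Components of vectors and tensors are numbered from 0.  A tensor of order \<open>m\<close> and dimension
  \<open>n\<close> is a function of the list of its \<open>m\<close> indices, extended by 0 to all other lists.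
\<close>

definition index_lists :: "nat \<Rightarrow> nat \<Rightarrow> nat list set" where
  "index_lists m n = {is. length is = m \<and> set is \<subseteq> {..<n}}"

definition tensors :: "nat \<Rightarrow> nat \<Rightarrow> (nat list \<Rightarrow> real) set" where
  "tensors m n = {T. \<forall>is. is \<notin> index_lists m n \<longrightarrow> T is = 0}"

definition vecs :: "nat \<Rightarrow> (nat \<Rightarrow> real) set" where
  "vecs n = topspace (Euclidean_space n)"

definition pos_vecs :: "nat \<Rightarrow> (nat \<Rightarrow> real) set" where
  "pos_vecs n = {v \<in> vecs n. \<forall>i<n. 0 < v i}"

definition vec_tuples :: "nat \<Rightarrow> nat \<Rightarrow> (nat \<Rightarrow> nat \<Rightarrow> real) set" where
  "vec_tuples n k = {x. (\<forall>j\<le>k. x j \<in> vecs n) \<and> (\<forall>j>k. x j = (\<lambda>_. 0))}"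

definition tensor_app :: "nat \<Rightarrow> nat \<Rightarrow> (nat list \<Rightarrow> real) \<Rightarrow> (nat \<Rightarrow> real) \<Rightarrow> nat \<Rightarrow> real" where
  "tensor_app m n T x =
     (\<lambda>i. if i < n then \<Sum>is\<in>index_lists (m - 1) n. T (i # is) * prod_list (map x is) else 0)"

definition wedge :: "(nat \<Rightarrow> real) \<Rightarrow> (nat \<Rightarrow> real) \<Rightarrow> nat \<Rightarrow> real" where
  "wedge x y = (\<lambda>i. min (x i) (y i))"

definition SOL ::
  "nat \<Rightarrow> nat \<Rightarrow> nat \<Rightarrow> (nat \<Rightarrow> nat list \<Rightarrow> real) \<Rightarrow> (nat \<Rightarrow> nat \<Rightarrow> real) \<Rightarrow> (nat \<Rightarrow> real)
     \<Rightarrow> (nat \<Rightarrow> nat \<Rightarrow> real) set" where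
  "SOL m n k A d q = {x \<in> vec_tuples n k.
     tensor_app m n (A 0) (x 0) = (\<lambda>i. q i + (\<Sum>j=1..k. tensor_app m n (A j) (x j) i)) \<and>
     wedge (x 0) (x 1) = (\<lambda>_. 0) \<and>
     (\<forall>j\<in>{1..k-1}. wedge (\<lambda>i. d j i - x j i) (x (j + 1)) = (\<lambda>_. 0))}"

definition EHR0 :: "nat \<Rightarrow> nat \<Rightarrow> nat \<Rightarrow> (nat \<Rightarrow> nat list \<Rightarrow> real) \<Rightarrow> bool" where
  "EHR0 m n k A \<longleftrightarrow>
     {x \<in> vec_tuples n k.
        tensor_app m n (A 0) (x 0) = (\<lambda>i. \<Sum>j=1..k. tensor_app m n (A j) (x j) i) \<and>
        (\<forall>i\<in>{1..k}. wedge (x 0) (x i) = (\<lambda>_. 0))} = {\<lambda>_ _. 0}"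

definition Psi ::
  "nat \<Rightarrow> nat \<Rightarrow> nat \<Rightarrow> (nat \<Rightarrow> nat list \<Rightarrow> real) \<Rightarrow> (nat \<Rightarrow> nat \<Rightarrow> real) \<Rightarrow> nat \<Rightarrow> nat \<Rightarrow> real" where
  "Psi m n k A x =
     (\<lambda>j. if j < k then wedge (x 0) (x (j + 1))
          else if j = k
          then (\<lambda>i. tensor_app m n (A 0) (x 0) i - (\<Sum>l=1..k. tensor_app m n (A l) (x l) i))
          else (\<lambda>_. 0))"

text \<open>
  Identification of $(R^n)^{k+1}$ with $R^{(k+1)n}$ by concatenation.
\<close>

definition flat :: "nat \<Rightarrow> nat \<Rightarrow> (nat \<Rightarrow> nat \<Rightarrow> real) \<Rightarrow> nat \<Rightarrow> real" where
  "flat n k x = (\<lambda>l. if l < (k + 1) * n then x (l div n) (l mod n) else 0)"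

definition unflat :: "nat \<Rightarrow> nat \<Rightarrow> (nat \<Rightarrow> real) \<Rightarrow> nat \<Rightarrow> nat \<Rightarrow> real" where
  "unflat n k v = (\<lambda>j i. if j \<le> k \<and> i < n then v (j * n + i) else 0)"

definition tensor_degree ::
  "nat \<Rightarrow> nat \<Rightarrow> nat \<Rightarrow> (nat \<Rightarrow> nat list \<Rightarrow> real) \<Rightarrow> (nat \<Rightarrow> real) set \<Rightarrow> int" where
  "tensor_degree m n k A \<Omega> =
     brouwer_degree ((k + 1) * n) (\<lambda>v. flat n k (Psi m n k A (unflat n k v))) \<Omega> (\<lambda>_. 0)"

end

theory Submission
  imports Defs
begin

text \<open>
  The solutions of the problem with data \<open>d\<close> and \<open>q\<close> are the zeros of a map on
  $(R^n)^{k+1}$ which is joined to $\Psi$ by the homotopy with components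
  $x_0 \wedge x_1$, $((1-t)x_0 + t(d_j - x_j)) \wedge x_{j+1}$ for $1 \le j < k$, and
  $A_0 x_0^{m-1} - \sum_j A_j x_j^{m-1} - tq$.

  At every stage \<open>t\<close>, every zero satisfies $x_0 \wedge x_j = 0$ for all \<open>j\<close>, although the
  equations say this literally only at \<open>t = 0\<close>: in a coordinate where $x_0$ is positive, $x_1$
  vanishes, hence $(1-t)x_0 + t(d_1 - x_1)$ is positive because $d_1$ is, hence $x_2$ vanishes, and
  so on along the chain (lemma \<open>complementarity_chain\<close>).  The conditions $x_0 \wedge x_j = 0$ define
  a closed cone on which the $EHR_0$ property makes $A_0 x_0^{m-1} - \sum_j A_j x_j^{m-1}$
  vanish only at the origin.  By homogeneity and compactness of the unit sphere, the norm of this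
  vector is at least $c |x|^{m-1}$ on the cone (lemma \<open>EHR0_coercive\<close>).  Since it equals $t|q|$
  at a zero, all zeros of all stages lie in one ball.

  The degree is therefore the same for $\Psi$ and for the map whose zeros are the solutions, and
  being nonzero it forces a solution to exist; compactness follows from the same bound.  The
  properties of the degree that enter (excision, homotopy invariance, vanishing in the absence of
  zeros) come from continuity of the collapse map, by which \<^const>\<open>degree_map\<close> is defined, and
  homotopy invariance of the degree of self-maps of the sphere.
\<close>

section \<open>Euclidean space as a subspace of the sequences\<close>

lemma continuous_on_eucl_norm:
  assumes "continuous_on S f"
  shows "continuous_on S (\<lambda>x. eucl_norm N (f x))"
  unfolding eucl_norm_def L2_set_def
  by (intro continuous_intros continuous_on_product_then_coordinatewise[OF assms])

lemma eucl_norm_nonneg: "0 \<le> eucl_norm N v"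
  by (simp add: eucl_norm_def L2_set_nonneg)

lemma eucl_norm_sq: "(eucl_norm N v)\<^sup>2 = (\<Sum>i<N. (v i)\<^sup>2)"
  by (simp add: eucl_norm_def L2_set_def sum_nonneg)

lemma eucl_norm_scale: "eucl_norm N (\<lambda>i. c * v i) = \<bar>c\<bar> * eucl_norm N v"
proof -
  have "(\<Sum>i<N. (c * v i)\<^sup>2) = c\<^sup>2 * (\<Sum>i<N. (v i)\<^sup>2)"
    by (simp add: power_mult_distrib sum_distrib_left)
  then show ?thesis
    by (simp add: eucl_norm_def L2_set_def real_sqrt_mult)
qed

lemma eucl_norm_eq_0: "eucl_norm N v = 0 \<longleftrightarrow> (\<forall>i<N. v i = 0)"
  by (auto simp add: eucl_norm_def L2_set_eq_0_iff)

lemma abs_le_eucl_norm: "i < N \<Longrightarrow> \<bar>v i\<bar> \<le> eucl_norm N v"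
  using member_le_L2_set[of "{..<N}" i "\<lambda>i. \<bar>v i\<bar>"] by (simp add: eucl_norm_def L2_set_def)

lemma vecs_iff: "v \<in> vecs N \<longleftrightarrow> (\<forall>i\<ge>N. v i = 0)"
  by (simp add: vecs_def topspace_Euclidean_space)

lemma Euclidean_space_eq: "Euclidean_space N = top_of_set (vecs N)"
  by (simp add: Euclidean_space_def vecs_def topspace_Euclidean_space euclidean_product_topology)

lemma closed_vecs: "closed (vecs N)"
  using closedin_Euclidean_space_iff[of N "vecs N"] closedin_topspace[of "Euclidean_space N"]
  by (simp add: vecs_def)

lemma compact_eucl_norm_le: "compact {v \<in> vecs N. eucl_norm N v \<le> b}"
proof -
  have 1: "compact (PiE UNIV (\<lambda>i. if i < N then {-b..b} else {0::real}))"
    using compactin_PiE[of "\<lambda>_. euclidean :: real topology" UNIV "\<lambda>i::nat. if i < N then {-b..b} else {0::real}"]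
    by (simp add: euclidean_product_topology)
  have 2: "closed {v \<in> vecs N. eucl_norm N v \<le> b}"
    using continuous_closed_preimage[of "vecs N" "eucl_norm N" "{..b}"] closed_vecs
      continuous_on_eucl_norm[of "vecs N" "\<lambda>x. x" N]
    by (simp add: vimage_def Int_def)
  have 3: "{v \<in> vecs N. eucl_norm N v \<le> b} \<subseteq> PiE UNIV (\<lambda>i. if i < N then {-b..b} else {0::real})"
  proof
    fix v assume v: "v \<in> {v \<in> vecs N. eucl_norm N v \<le> b}"
    have "v i \<in> (if i < N then {-b..b} else {0})" for i
      using v abs_le_eucl_norm[of i N v] by (auto simp: vecs_iff abs_le_iff)
    then show "v \<in> PiE UNIV (\<lambda>i. if i < N then {-b..b} else {0})"
      unfolding PiE_UNIV_domain Pi_iff by blast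
  qed
  have "compact (PiE UNIV (\<lambda>i. if i < N then {-b..b} else {0::real}) \<inter> {v \<in> vecs N. eucl_norm N v \<le> b})"
    using 1 2 by (rule compact_Int_closed)
  with 3 show ?thesis by (simp add: Int_absorb1)
qed

section \<open>Stereographic projection and the collapse map\<close>

lemma nsphere_eq: "nsphere N = top_of_set (topspace (nsphere N))"
  by (simp add: nsphere euclidean_product_topology)

lemma in_nsphere_iff:
  "u \<in> topspace (nsphere N) \<longleftrightarrow> (eucl_norm N u)\<^sup>2 + (u N)\<^sup>2 = 1 \<and> (\<forall>i>N. u i = 0)"
  by (simp add: nsphere eucl_norm_sq flip: lessThan_Suc_atMost)

lemma north_pole_in_nsphere: "north_pole N \<in> topspace (nsphere N)"
proof -
  have "eucl_norm N (north_pole N) = 0"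
    by (auto simp: eucl_norm_eq_0 north_pole_def)
  then show ?thesis by (simp add: in_nsphere_iff) (simp add: north_pole_def)
qed

lemma height_less_1:
  assumes "u \<in> topspace (nsphere N)" "u \<noteq> north_pole N"
  shows "u N < 1"
proof (rule ccontr)
  assume n: "\<not> u N < 1"
  have s: "(eucl_norm N u)\<^sup>2 + (u N)\<^sup>2 = 1" "\<forall>i>N. u i = 0"
    using assms by (auto simp: in_nsphere_iff)
  have "(u N)\<^sup>2 \<le> 1" using s(1) by (smt (verit) zero_le_power2)
  then have "u N = 1" using n by (simp add: abs_square_le_1)
  then have "eucl_norm N u = 0" using s(1) by simp
  then have "u = north_pole N"
    using \<open>u N = 1\<close> s(2) by (auto simp: eucl_norm_eq_0 north_pole_def fun_eq_iff) (metis nat_neq_iff)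
  with assms show False by simp
qed

lemma stereo_in_vecs: "stereo N u \<in> vecs N"
  by (simp add: vecs_iff stereo_def)

lemma inv_stereo_in_nsphere: "inv_stereo N v \<in> topspace (nsphere N)"
proof -
  define a where "a = eucl_norm N v"
  have p: "a\<^sup>2 + 1 > 0" by (simp add: add_nonneg_pos)
  have "(eucl_norm N (inv_stereo N v))\<^sup>2 = (eucl_norm N (\<lambda>i. (2/(a\<^sup>2+1)) * v i))\<^sup>2"
    by (simp add: eucl_norm_sq inv_stereo_def a_def)
  also have "\<dots> = (2/(a\<^sup>2+1))\<^sup>2 * a\<^sup>2"
    unfolding eucl_norm_scale by (simp add: power_mult_distrib power_divide a_def)
  finally have e: "(eucl_norm N (inv_stereo N v))\<^sup>2 = (2/(a\<^sup>2+1))\<^sup>2 * a\<^sup>2" .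
  have "(2/(a\<^sup>2+1))\<^sup>2 * a\<^sup>2 + ((a\<^sup>2-1)/(a\<^sup>2+1))\<^sup>2 = 1"
    using p by (simp add: power_divide field_simps) (simp add: power2_eq_square algebra_simps)
  then show ?thesis
    unfolding in_nsphere_iff e by (simp add: inv_stereo_def a_def)
qed

lemma inv_stereo_neq_pole: "inv_stereo N v \<noteq> north_pole N"
proof
  assume "inv_stereo N v = north_pole N"
  then have "inv_stereo N v N = 1" by (simp add: north_pole_def)
  moreover have "(eucl_norm N v)\<^sup>2 + 1 > 0" by (simp add: add_nonneg_pos)
  ultimately show False by (simp add: inv_stereo_def field_simps)
qed

lemma stereo_inv_stereo:
  assumes "v \<in> vecs N" shows "stereo N (inv_stereo N v) = v"
proof -
  define a where "a = eucl_norm N v"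
  have p: "a\<^sup>2 + 1 > 0" by (simp add: add_nonneg_pos)
  have q: "1 - (a\<^sup>2 - 1)/(a\<^sup>2 + 1) = 2/(a\<^sup>2+1)" using p by (simp add: field_simps)
  show ?thesis
    using assms p by (auto simp: stereo_def inv_stereo_def q vecs_iff simp flip: a_def)
qed

lemma inv_stereo_stereo:
  assumes u: "u \<in> topspace (nsphere N)" "u \<noteq> north_pole N"
  shows "inv_stereo N (stereo N u) = u"
proof -
  define h where "h = u N"
  have h: "h < 1" using height_less_1[OF u] by (simp add: h_def)
  have s: "(eucl_norm N u)\<^sup>2 = 1 - h\<^sup>2" "\<forall>i>N. u i = 0"
    using assms by (auto simp: in_nsphere_iff h_def algebra_simps)
  have "(eucl_norm N (stereo N u))\<^sup>2 = (eucl_norm N (\<lambda>i. (1/(1-h)) * u i))\<^sup>2"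
    by (simp add: eucl_norm_sq stereo_def h_def)
  also have "\<dots> = (1/(1-h))\<^sup>2 * (1 - h\<^sup>2)"
    unfolding eucl_norm_scale power_mult_distrib s by (simp add: power_divide)
  also have "\<dots> = (1 + h)/(1 - h)"
  proof -
    have "1 - h\<^sup>2 = (1 - h) * (1 + h)" by (simp add: power2_eq_square algebra_simps)
    then show ?thesis using h by (simp add: power2_eq_square)
  qed
  finally have e: "(eucl_norm N (stereo N u))\<^sup>2 = (1 + h)/(1 - h)" .
  have e1: "(1 + h)/(1 - h) + 1 = 2/(1-h)" "(1 + h)/(1 - h) - 1 = 2*h/(1-h)"
    using h by (auto simp: field_simps)
  show ?thesis
    using h s(2) unfolding inv_stereo_def e e1
    by (auto simp: fun_eq_iff stereo_def h_def not_less_iff_gr_or_eq)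
qed

lemma continuous_on_inv_stereo: "continuous_on S (inv_stereo N)"
proof (rule continuous_on_coordinatewise_then_product)
  fix i
  have p: "(eucl_norm N v)\<^sup>2 + 1 \<noteq> 0" for v :: "nat \<Rightarrow> real"
    using add_nonneg_pos[OF zero_le_power2 zero_less_one, of "eucl_norm N v"] by linarith
  have c: "continuous_on S (\<lambda>v. v i)"
    by (rule continuous_on_product_then_coordinatewise) (rule continuous_on_id)
  consider "i < N" | "i = N" | "i > N" by linarith
  then show "continuous_on S (\<lambda>v. inv_stereo N v i)"
    by cases (auto simp: inv_stereo_def p intro!: continuous_intros c continuous_on_eucl_norm)
qed

lemma continuous_on_stereo:
  assumes "\<And>u. u \<in> S \<Longrightarrow> u N \<noteq> 1"
  shows "continuous_on S (stereo N)"
proof (rule continuous_on_coordinatewise_then_product)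
  fix i
  have c: "continuous_on S (\<lambda>v. v i)" for i
    by (rule continuous_on_product_then_coordinatewise) (rule continuous_on_id)
  show "continuous_on S (\<lambda>v. stereo N v i)"
    by (cases "i < N") (auto simp: stereo_def dest: assms intro!: continuous_intros c)
qed

text \<open>
  Substituting $|w/(r-s)| = s/(r-s)$, where $s = |w|$, into the inverse stereographic projection
  and clearing $(r-s)^2$ leaves a formula without a pole at $s = r$.  Capping \<open>s\<close> at \<open>r\<close> makes the
  same formula yield the north pole for $|w| \ge r$.  The denominator $s^2 + (r-s)^2$ never vanishes,
  so continuity in \<open>r\<close> and \<open>w\<close> jointly can be read off.
\<close>

lemma collapse_eq:
  assumes "0 < r"
  shows "collapse N r w =
    (\<lambda>i. let s = min (eucl_norm N w) r; D = s\<^sup>2 + (r - s)\<^sup>2 in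
      if i < N then 2 * w i * (r - s) / D else if i = N then (s\<^sup>2 - (r - s)\<^sup>2) / D else 0)"
proof (cases "eucl_norm N w < r")
  case True
  define s where "s = eucl_norm N w"
  have s: "r - s > 0" using True by (simp add: s_def)
  have "(eucl_norm N (\<lambda>i. (1/(r-s)) * w i))\<^sup>2 = s\<^sup>2/(r-s)\<^sup>2"
    unfolding eucl_norm_scale power_mult_distrib by (simp add: s_def power_divide)
  then have e: "(eucl_norm N (\<lambda>i. w i/(r-s)))\<^sup>2 = s\<^sup>2/(r-s)\<^sup>2" by simp
  have e1: "s\<^sup>2/(r-s)\<^sup>2 + 1 = (s\<^sup>2 + (r-s)\<^sup>2)/(r-s)\<^sup>2" "s\<^sup>2/(r-s)\<^sup>2 - 1 = (s\<^sup>2 - (r-s)\<^sup>2)/(r-s)\<^sup>2"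
    using s by (auto simp: field_simps)
  have "2 * (x / (r-s)) / (D/(r-s)\<^sup>2) = 2 * x * (r-s) / D" for x D
    using s by (cases "D = 0") (auto simp: field_simps power2_eq_square)
  then show ?thesis
    using True s unfolding collapse_def s_def[symmetric] inv_stereo_def e e1 by (auto simp: Let_def)
next
  case False
  then show ?thesis
    using assms by (auto simp: collapse_def north_pole_def Let_def)
qed

lemma continuous_on_collapse:
  assumes r: "continuous_on S r" "\<And>x. x \<in> S \<Longrightarrow> 0 < r x" and g: "continuous_on S g"
  shows "continuous_on S (\<lambda>x. collapse N (r x) (g x))"
proof (rule continuous_on_coordinatewise_then_product)
  fix i
  define s where "s x = min (eucl_norm N (g x)) (r x)" for x
  have cs: "continuous_on S s"
    unfolding s_def by (intro continuous_intros continuous_on_eucl_norm r g)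
  have D: "(s x)\<^sup>2 + (r x - s x)\<^sup>2 \<noteq> 0" if "x \<in> S" for x
    using r(2)[OF that] by (simp add: sum_power2_eq_zero_iff)
  have "continuous_on S (\<lambda>x. if i < N then 2 * g x i * (r x - s x) / ((s x)\<^sup>2 + (r x - s x)\<^sup>2)
       else if i = N then ((s x)\<^sup>2 - (r x - s x)\<^sup>2) / ((s x)\<^sup>2 + (r x - s x)\<^sup>2) else 0)"
  proof -
    consider "i < N" | "i = N" | "i > N" by linarith
    then show ?thesis
      using D by cases (auto intro!: continuous_intros cs r(1) continuous_on_product_then_coordinatewise[OF g]
          simp del: sum_power2_eq_zero_iff)
  qed
  then show "continuous_on S (\<lambda>x. collapse N (r x) (g x) i)"
    by (rule continuous_on_eq) (simp add: collapse_eq r(2) s_def Let_def)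
qed

lemma collapse_in_nsphere: "collapse N r w \<in> topspace (nsphere N)"
  by (simp add: collapse_def inv_stereo_in_nsphere north_pole_in_nsphere)

section \<open>Properties of the Brouwer degree\<close>

lemma frontier_of_open_Euclidean_space:
  assumes "openin (Euclidean_space N) \<Omega>"
  shows "Euclidean_space N frontier_of \<Omega> = closure \<Omega> - \<Omega>"
proof -
  have sub: "\<Omega> \<subseteq> vecs N" using openin_subset[OF assms] by (simp add: vecs_def)
  then have "closure \<Omega> \<subseteq> vecs N" by (simp add: closed_vecs closure_minimal)
  then show ?thesis
    using sub unfolding frontier_of_openin[OF assms]
    by (auto simp: Euclidean_space_eq closure_of_subtopology Int_absorb1)
qed

lemma closure_subset_vecs:
  assumes "openin (Euclidean_space N) \<Omega>"
  shows "closure \<Omega> \<subseteq> vecs N"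
  using openin_subset[OF assms] by (simp add: vecs_def[symmetric] closed_vecs closure_minimal)

lemma compact_closure_eucl_bounded:
  assumes "openin (Euclidean_space N) \<Omega>" "eucl_bounded N \<Omega>"
  shows "compact (closure \<Omega>)"
proof -
  obtain b where b: "\<And>v. v \<in> \<Omega> \<Longrightarrow> eucl_norm N v \<le> b"
    using assms(2) by (auto simp: eucl_bounded_def)
  let ?C = "{v \<in> vecs N. eucl_norm N v \<le> b}"
  have "\<Omega> \<subseteq> ?C" using b openin_subset[OF assms(1)] by (auto simp: vecs_def)
  then have "closure \<Omega> \<subseteq> ?C"
    by (simp add: closure_minimal compact_imp_closed compact_eucl_norm_le)
  then show ?thesis
    using compact_Int_closed[OF compact_eucl_norm_le closed_closure, of N b \<Omega>]
    by (simp add: Int_absorb1)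
qed

text \<open>
  The two clauses in the definition of \<^const>\<open>degree_map\<close> are continuous on the closed sets of
  points that lie over \<open>closure \<Omega>\<close> and of points that do not lie over \<open>\<Omega>\<close>.  These sets meet over
  the frontier, where the values of the map have distance at least \<open>r t\<close> from \<open>y\<close> and collapse to
  the pole.  Hence the clauses agree there and paste to a homotopy.  Letting the radius vary along
  with the map allows the same lemma to change the radius alone.
\<close>

lemma homotopic_degree_maps:
  fixes f :: "real \<Rightarrow> (nat \<Rightarrow> real) \<Rightarrow> nat \<Rightarrow> real"
  assumes op: "openin (Euclidean_space N) \<Omega>" and bd: "eucl_bounded N \<Omega>"
    and f: "continuous_on ({0..1} \<times> closure \<Omega>) (\<lambda>p. f (fst p) (snd p))"
    and r: "continuous_on {0..1} r" "\<And>t. t \<in> {0..1} \<Longrightarrow> 0 < r t"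
    and fr: "\<And>t x. t \<in> {0..1} \<Longrightarrow> x \<in> Euclidean_space N frontier_of \<Omega> \<Longrightarrow>
                r t \<le> eucl_norm N (\<lambda>i. f t x i - y i)"
  shows "homotopic_with (\<lambda>_. True) (nsphere N) (nsphere N)
           (degree_map N (f 0) \<Omega> y (r 0)) (degree_map N (f 1) \<Omega> y (r 1))"
proof -
  define S where "S = topspace (nsphere N)"
  define C where "C = inv_stereo N ` closure \<Omega>"
  define U where "U = {u \<in> S. u \<noteq> north_pole N \<and> stereo N u \<in> \<Omega>}"
  define h where "h p = degree_map N (f (fst p)) \<Omega> y (r (fst p)) (snd p)" for p
  have clO: "closure \<Omega> \<subseteq> vecs N" by (rule closure_subset_vecs[OF op])
  have C: "u \<in> S" "u \<noteq> north_pole N" "stereo N u \<in> closure \<Omega>" "u N \<noteq> 1" if "u \<in> C" for u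
  proof -
    show *: "u \<in> S" "u \<noteq> north_pole N"
      using that inv_stereo_in_nsphere inv_stereo_neq_pole by (auto simp: C_def S_def)
    show "stereo N u \<in> closure \<Omega>"
      using that clO by (auto simp: C_def stereo_inv_stereo subset_iff)
    show "u N \<noteq> 1"
      using height_less_1[of u N] * by (auto simp: S_def)
  qed
  \<comment> \<open>Boundedness of \<open>\<Omega>\<close> keeps \<open>C\<close> away from the pole: \<open>C\<close> is the image of a compact set.\<close>
  have "closed C"
    unfolding C_def
    by (intro compact_imp_closed compact_continuous_image continuous_on_inv_stereo
          compact_closure_eucl_bounded[OF op bd])
  then have clC: "closedin (top_of_set S) C"
    using C(1) by (simp add: closed_subset subsetI)
  have "openin (top_of_set S) (S - {north_pole N})"
    by (simp add: openin_delete)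
  moreover have "openin (top_of_set (S - {north_pole N})) U"
  proof -
    have "continuous_on (S - {north_pole N}) (stereo N)"
    proof (rule continuous_on_stereo)
      fix u assume "u \<in> S - {north_pole N}"
      then show "u N \<noteq> 1" using height_less_1[of u N] by (auto simp: S_def)
    qed
    then have "openin (top_of_set (S - {north_pole N})) ((S - {north_pole N}) \<inter> stereo N -` \<Omega>)"
      using op by (intro continuous_openin_preimage[of _ _ "vecs N"])
        (auto simp: stereo_in_vecs Euclidean_space_eq)
    moreover have "(S - {north_pole N}) \<inter> stereo N -` \<Omega> = U"
      by (auto simp: U_def)
    ultimately show ?thesis by simp
  qed
  ultimately have "openin (top_of_set S) U" by (meson openin_trans)
  then have clV: "closedin (top_of_set S) (S - U)"
    by (simp add: closedin_diff)
  have UC: "U \<subseteq> C"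
  proof
    fix u assume "u \<in> U"
    then have "inv_stereo N (stereo N u) = u" "stereo N u \<in> closure \<Omega>"
      using closure_subset by (auto simp: U_def S_def inv_stereo_stereo)
    then show "u \<in> C" unfolding C_def by (metis imageI)
  qed
  have un: "{0..1::real} \<times> S = {0..1} \<times> C \<union> {0..1} \<times> (S - U)"
    using UC C(1) by blast
  have "continuous_on ({0..1} \<times> C)
      (\<lambda>p. collapse N (r (fst p)) (\<lambda>i. f (fst p) (stereo N (snd p)) i - y i))"
  proof (rule continuous_on_collapse)
    show "continuous_on ({0..1} \<times> C) (\<lambda>p. r (fst p))"
      by (rule continuous_on_compose2[OF r(1) continuous_on_fst]) (auto intro: continuous_on_id)
    show "0 < r (fst p)" if "p \<in> {0..1} \<times> C" for p using that r(2) by auto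
    have "continuous_on ({0..1} \<times> C) (\<lambda>p. stereo N (snd p))"
      by (rule continuous_on_compose2[OF continuous_on_stereo[of C N] continuous_on_snd])
        (auto simp: C(4) intro: continuous_on_id)
    then have "continuous_on ({0..1} \<times> C) (\<lambda>p. (fst p, stereo N (snd p)))"
      by (intro continuous_on_Pair continuous_on_fst continuous_on_id)
    from continuous_on_compose2[OF f this]
    have "continuous_on ({0..1} \<times> C) (\<lambda>p. f (fst p) (stereo N (snd p)))"
      using C(3) by force
    from continuous_on_product_then_coordinatewise[OF this]
    show "continuous_on ({0..1} \<times> C) (\<lambda>p i. f (fst p) (stereo N (snd p)) i - y i)"
      by (intro continuous_on_coordinatewise_then_product continuous_on_diff continuous_on_const)
  qed
  moreover have "collapse N (r (fst p)) (\<lambda>i. f (fst p) (stereo N (snd p)) i - y i) = north_pole N"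
    if "p \<in> {0..1} \<times> C" "\<not> (snd p \<noteq> north_pole N \<and> stereo N (snd p) \<in> \<Omega>)" for p
  proof -
    have "stereo N (snd p) \<in> Euclidean_space N frontier_of \<Omega>"
      using that C by (auto simp: frontier_of_open_Euclidean_space[OF op])
    then have "r (fst p) \<le> eucl_norm N (\<lambda>i. f (fst p) (stereo N (snd p)) i - y i)"
      using that fr by auto
    then show ?thesis by (simp add: collapse_def)
  qed
  ultimately have "continuous_on ({0..1} \<times> S) h"
    unfolding h_def degree_map_def un
    by (intro continuous_on_cases_local)
      (auto simp: U_def un[symmetric] closedin_Times clC clV[unfolded U_def] simp flip: un[unfolded U_def])
  moreover have "h \<in> {0..1} \<times> S \<rightarrow> S"
    by (auto simp: h_def degree_map_def S_def collapse_in_nsphere north_pole_in_nsphere)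
  ultimately have "continuous_map (prod_topology (top_of_set {0..1::real}) (nsphere N)) (nsphere N) h"
    by (subst (1 2) nsphere_eq) (simp add: S_def)
  then show ?thesis
    unfolding homotopic_with_def by (intro exI[of _ h]) (auto simp: h_def)
qed

lemma compact_closure_diff:
  assumes "openin (Euclidean_space N) \<Omega>" "eucl_bounded N \<Omega>" "openin (Euclidean_space N) W"
  shows "compact (closure \<Omega> - W)"
proof -
  obtain V where V: "open V" "W = V \<inter> vecs N"
    using assms(3) by (auto simp: Euclidean_space_eq openin_open)
  then have "closure \<Omega> - W = closure \<Omega> - V"
    using closure_subset_vecs[OF assms(1)] by auto
  then show ?thesis
    using compact_diff[OF compact_closure_eucl_bounded[OF assms(1,2)] V(1)] by simp
qed

lemma pos_lower_bound_on_compact: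
  fixes g :: "'a::topological_space \<Rightarrow> real"
  assumes "compact K" "continuous_on K g" "\<And>x. x \<in> K \<Longrightarrow> 0 < g x"
  obtains c where "0 < c" "\<And>x. x \<in> K \<Longrightarrow> c \<le> g x"
proof (cases "K = {}")
  case True
  then show ?thesis using that[of 1] by auto
next
  case False
  obtain x where "x \<in> K" "\<And>y. y \<in> K \<Longrightarrow> g x \<le> g y"
    using continuous_attains_inf[OF assms(1) False assms(2)] by auto
  then show ?thesis using that[of "g x"] assms(3) by auto
qed

lemma eucl_distance_lower_bound:
  fixes h :: "'a::topological_space \<Rightarrow> nat \<Rightarrow> real"
  assumes "compact K" "continuous_on K h"
    and "\<And>x. x \<in> K \<Longrightarrow> eucl_norm N (\<lambda>i. h x i - y i) \<noteq> 0"
  obtains r where "0 < r" "\<And>x. x \<in> K \<Longrightarrow> r \<le> eucl_norm N (\<lambda>i. h x i - y i)"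
proof (rule pos_lower_bound_on_compact[OF assms(1)])
  show "continuous_on K (\<lambda>x. eucl_norm N (\<lambda>i. h x i - y i))"
    by (intro continuous_on_eucl_norm continuous_on_coordinatewise_then_product
        continuous_on_diff continuous_on_const continuous_on_product_then_coordinatewise[OF assms(2)])
  show "0 < eucl_norm N (\<lambda>i. h x i - y i)" if "x \<in> K" for x
    using assms(3)[OF that] eucl_norm_nonneg[of N "\<lambda>i. h x i - y i"] by linarith
qed blast

text \<open>
  Moving \<open>r\<close> along a segment between two admissible radii is an admissible homotopy, which
  removes the arbitrary choice of radius in the definition of the degree.
\<close>

lemma brouwer_degree_eq_degree_map:
  assumes op: "openin (Euclidean_space N) \<Omega>" and bd: "eucl_bounded N \<Omega>"
    and g: "continuous_on (closure \<Omega>) g"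
    and r: "0 < r"
      "\<And>x. x \<in> Euclidean_space N frontier_of \<Omega> \<Longrightarrow> r \<le> eucl_norm N (\<lambda>i. g x i - y i)"
  shows "brouwer_degree N g \<Omega> y = Brouwer_degree2 N (degree_map N g \<Omega> y r)"
proof -
  define Q where "Q s \<longleftrightarrow> 0 < s \<and>
    (\<forall>x\<in>Euclidean_space N frontier_of \<Omega>. s \<le> eucl_norm N (\<lambda>i. g x i - y i))" for s
  define s where "s = (SOME s. Q s)"
  have "Q r" using r by (simp add: Q_def)
  then have "Q s" unfolding s_def by (rule someI)
  have "homotopic_with (\<lambda>_. True) (nsphere N) (nsphere N)
      (degree_map N g \<Omega> y ((\<lambda>t. (1 - t) * s + t * r) 0))
      (degree_map N g \<Omega> y ((\<lambda>t. (1 - t) * s + t * r) 1))"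
  proof (rule homotopic_degree_maps[where f = "\<lambda>_. g", OF op bd])
    show "continuous_on ({0..1::real} \<times> closure \<Omega>) (\<lambda>p. g (snd p))"
      by (rule continuous_on_compose2[OF g continuous_on_snd]) (auto intro: continuous_on_id)
    show "continuous_on {0..1} (\<lambda>t. (1 - t) * s + t * r)" by (intro continuous_intros)
    fix t :: real assume t: "t \<in> {0..1}"
    have "(1 - t) * (- s) + t * (- r) < 0"
      using t \<open>Q s\<close> r(1) by (intro convex_bound_lt) (auto simp: Q_def)
    then show "0 < (1 - t) * s + t * r" by simp
    fix x assume "x \<in> Euclidean_space N frontier_of \<Omega>"
    then show "(1 - t) * s + t * r \<le> eucl_norm N (\<lambda>i. g x i - y i)"
      using t \<open>Q s\<close> r(2) by (intro convex_bound_le) (auto simp: Q_def)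
  qed
  then have "Brouwer_degree2 N (degree_map N g \<Omega> y s) = Brouwer_degree2 N (degree_map N g \<Omega> y r)"
    by (intro Brouwer_degree2_homotopic) simp
  then show ?thesis
    by (simp add: brouwer_degree_def s_def Q_def[abs_def])
qed

text \<open>
  If \<open>r\<close> bounds the distance to \<open>y\<close> from below on all of \<open>closure \<Omega>' - \<Omega>\<close>, both degree maps
  send the points over \<open>\<Omega>' - \<Omega>\<close> to the pole, and hence coincide.
\<close>

lemma brouwer_degree_excision:
  assumes op: "openin (Euclidean_space N) \<Omega>" and op': "openin (Euclidean_space N) \<Omega>'"
    and bd': "eucl_bounded N \<Omega>'" and sub: "\<Omega> \<subseteq> \<Omega>'"
    and g: "continuous_on (closure \<Omega>') g"
    and nz: "\<And>x. x \<in> closure \<Omega>' - \<Omega> \<Longrightarrow> eucl_norm N (\<lambda>i. g x i - y i) \<noteq> 0"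
  shows "brouwer_degree N g \<Omega> y = brouwer_degree N g \<Omega>' y"
proof -
  have bd: "eucl_bounded N \<Omega>" using bd' sub by (auto simp: eucl_bounded_def)
  have cl: "closure \<Omega> \<subseteq> closure \<Omega>'" using sub by (rule closure_mono)
  obtain r where r: "0 < r" "\<And>x. x \<in> closure \<Omega>' - \<Omega> \<Longrightarrow> r \<le> eucl_norm N (\<lambda>i. g x i - y i)"
    using eucl_distance_lower_bound[OF compact_closure_diff[OF op' bd' op]
        continuous_on_subset[OF g Diff_subset] nz] by blast
  have "brouwer_degree N g \<Omega> y = Brouwer_degree2 N (degree_map N g \<Omega> y r)"
    using r cl by (intro brouwer_degree_eq_degree_map[OF op bd continuous_on_subset[OF g cl]])
      (auto simp: frontier_of_open_Euclidean_space[OF op])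
  also have "degree_map N g \<Omega> y r = degree_map N g \<Omega>' y r"
  proof
    fix u
    have "collapse N r (\<lambda>i. g (stereo N u) i - y i) = north_pole N" if "stereo N u \<in> \<Omega>' - \<Omega>"
      using r(2)[of "stereo N u"] that closure_subset[of \<Omega>'] by (auto simp: collapse_def)
    then show "degree_map N g \<Omega> y r u = degree_map N g \<Omega>' y r u"
      using sub by (auto simp: degree_map_def)
  qed
  also have "Brouwer_degree2 N \<dots> = brouwer_degree N g \<Omega>' y"
    using r sub by (intro brouwer_degree_eq_degree_map[OF op' bd' g, symmetric])
      (auto simp: frontier_of_open_Euclidean_space[OF op'])
  finally show ?thesis .
qed

lemma brouwer_degree_homotopy_invariant:
  fixes f :: "real \<Rightarrow> (nat \<Rightarrow> real) \<Rightarrow> nat \<Rightarrow> real"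
  assumes op: "openin (Euclidean_space N) \<Omega>" and bd: "eucl_bounded N \<Omega>"
    and f: "continuous_on ({0..1} \<times> closure \<Omega>) (\<lambda>p. f (fst p) (snd p))"
    and nz: "\<And>t x. t \<in> {0..1} \<Longrightarrow> x \<in> closure \<Omega> - \<Omega> \<Longrightarrow> eucl_norm N (\<lambda>i. f t x i - y i) \<noteq> 0"
  shows "brouwer_degree N (f 0) \<Omega> y = brouwer_degree N (f 1) \<Omega> y"
proof -
  obtain r where r: "0 < r" "\<And>p. p \<in> {0..1} \<times> (closure \<Omega> - \<Omega>) \<Longrightarrow>
      r \<le> eucl_norm N (\<lambda>i. f (fst p) (snd p) i - y i)"
  proof (rule eucl_distance_lower_bound)
    show "compact ({0..1::real} \<times> (closure \<Omega> - \<Omega>))"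
      by (intro compact_Times compact_closure_diff[OF op bd op] compact_Icc)
    show "continuous_on ({0..1} \<times> (closure \<Omega> - \<Omega>)) (\<lambda>p. f (fst p) (snd p))"
      by (intro continuous_on_subset[OF f]) auto
    show "eucl_norm N (\<lambda>i. f (fst p) (snd p) i - y i) \<noteq> 0" if "p \<in> {0..1} \<times> (closure \<Omega> - \<Omega>)" for p
      using that by (intro nz) auto
  qed blast
  have fr: "r \<le> eucl_norm N (\<lambda>i. f t x i - y i)"
    if "t \<in> {0..1}" "x \<in> Euclidean_space N frontier_of \<Omega>" for t x
    using r(2)[of "(t, x)"] that by (auto simp: frontier_of_open_Euclidean_space[OF op])
  have deg: "brouwer_degree N (f t) \<Omega> y = Brouwer_degree2 N (degree_map N (f t) \<Omega> y r)"
    if t: "t \<in> {0..1}" for t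
  proof (rule brouwer_degree_eq_degree_map[OF op bd _ r(1) fr[OF t]])
    have "continuous_on (closure \<Omega>) (\<lambda>x. (t, x))"
      by (intro continuous_on_Pair continuous_on_const continuous_on_id)
    from continuous_on_compose2[OF f this] show "continuous_on (closure \<Omega>) (f t)"
      using t by force
  qed
  have "Brouwer_degree2 N (degree_map N (f 0) \<Omega> y r) = Brouwer_degree2 N (degree_map N (f 1) \<Omega> y r)"
    by (intro Brouwer_degree2_homotopic homotopic_degree_maps[where r = "\<lambda>_. r"] op bd f fr r(1)
        continuous_on_const)
  then show ?thesis by (simp add: deg)
qed

text \<open>
  A radius below the distance from \<open>y\<close> to the image of \<open>closure \<Omega>\<close> turns the degree map into a
  constant.
\<close>

lemma brouwer_degree_eq_0:
  assumes op: "openin (Euclidean_space N) \<Omega>" and bd: "eucl_bounded N \<Omega>"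
    and g: "continuous_on (closure \<Omega>) g"
    and nz: "\<And>x. x \<in> closure \<Omega> \<Longrightarrow> eucl_norm N (\<lambda>i. g x i - y i) \<noteq> 0"
  shows "brouwer_degree N g \<Omega> y = 0"
proof -
  obtain r where r: "0 < r" "\<And>x. x \<in> closure \<Omega> \<Longrightarrow> r \<le> eucl_norm N (\<lambda>i. g x i - y i)"
    using eucl_distance_lower_bound[OF compact_closure_eucl_bounded[OF op bd] g nz] by blast
  have "brouwer_degree N g \<Omega> y = Brouwer_degree2 N (degree_map N g \<Omega> y r)"
    using r by (intro brouwer_degree_eq_degree_map[OF op bd g])
      (auto simp: frontier_of_open_Euclidean_space[OF op])
  also have "degree_map N g \<Omega> y r = (\<lambda>_. north_pole N)"
  proof
    fix u
    have "collapse N r (\<lambda>i. g (stereo N u) i - y i) = north_pole N" if "stereo N u \<in> \<Omega>"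
      using r(2)[of "stereo N u"] that closure_subset[of \<Omega>] by (auto simp: collapse_def)
    then show "degree_map N g \<Omega> y r u = north_pole N" by (auto simp: degree_map_def)
  qed
  finally show ?thesis by (simp add: Brouwer_degree2_const)
qed

text \<open>
  Excision replaces \<open>\<Omega>\<close> by a ball that contains the zeros of every stage of the homotopy; on that
  ball the degree is invariant, and it would vanish if the last stage had no zero.
\<close>

theorem brouwer_degree_nonzero_imp_zero:
  fixes f :: "real \<Rightarrow> (nat \<Rightarrow> real) \<Rightarrow> nat \<Rightarrow> real"
  assumes op: "openin (Euclidean_space N) \<Omega>" and bd: "eucl_bounded N \<Omega>"
    and f: "continuous_on ({0..1} \<times> vecs N) (\<lambda>p. f (fst p) (snd p))"
    and f0: "\<And>x. x \<in> vecs N \<Longrightarrow> eucl_norm N (f 0 x) = 0 \<Longrightarrow> x \<in> \<Omega>"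
    and R: "\<And>t x. t \<in> {0..1} \<Longrightarrow> x \<in> vecs N \<Longrightarrow> eucl_norm N (f t x) = 0 \<Longrightarrow> eucl_norm N x < R"
    and deg: "brouwer_degree N (f 0) \<Omega> (\<lambda>_. 0) \<noteq> 0"
  obtains x where "x \<in> vecs N" "eucl_norm N (f 1 x) = 0"
proof (rule ccontr)
  assume "\<not> thesis"
  then have f1: "\<And>x. x \<in> vecs N \<Longrightarrow> eucl_norm N (f 1 x) \<noteq> 0"
    using that by blast
  obtain b where b: "\<And>x. x \<in> \<Omega> \<Longrightarrow> eucl_norm N x < b" "R \<le> b"
  proof -
    obtain b where "\<And>x. x \<in> \<Omega> \<Longrightarrow> eucl_norm N x \<le> b"
      using bd by (auto simp: eucl_bounded_def)
    then show thesis using that[of "max (b+1) R"] by force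
  qed
  \<comment> \<open>A ball of radius at least \<open>R\<close> around the origin which also contains \<open>\<Omega>\<close>.\<close>
  define B where "B = {x \<in> vecs N. eucl_norm N x < b}"
  have opB: "openin (Euclidean_space N) B"
    using continuous_openin_preimage_gen[OF continuous_on_eucl_norm[OF continuous_on_id, of "vecs N" N],
        of "{..<b}"]
    by (simp add: Euclidean_space_eq B_def vimage_def Int_def)
  have bdB: "eucl_bounded N B"
    by (auto simp: B_def eucl_bounded_def intro!: exI[of _ b])
  have sub: "\<Omega> \<subseteq> B"
    using openin_subset[OF op] b by (auto simp: B_def vecs_def)
  have clB: "closure B \<subseteq> vecs N" by (rule closure_subset_vecs[OF opB])
  have ft: "continuous_on (closure B) (f t)" if "t \<in> {0..1}" for t
  proof -
    have "continuous_on (closure B) (\<lambda>x. (t, x))"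
      by (intro continuous_on_Pair continuous_on_const continuous_on_id)
    from continuous_on_compose2[OF f this] show ?thesis using that clB by force
  qed
  have "brouwer_degree N (f 0) \<Omega> (\<lambda>_. 0) = brouwer_degree N (f 0) B (\<lambda>_. 0)"
    using f0 clB by (intro brouwer_degree_excision[OF op opB bdB sub ft]) auto
  also have "\<dots> = brouwer_degree N (f 1) B (\<lambda>_. 0)"
  proof (rule brouwer_degree_homotopy_invariant[OF opB bdB])
    show "continuous_on ({0..1} \<times> closure B) (\<lambda>p. f (fst p) (snd p))"
      using clB by (intro continuous_on_subset[OF f]) auto
    fix t :: real and x assume "t \<in> {0..1}" "x \<in> closure B - B"
    then show "eucl_norm N (\<lambda>i. f t x i - 0) \<noteq> 0"
      using R[of t x] clB b(2) by (force simp: B_def)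
  qed
  also have "\<dots> = 0"
    using f1 clB by (intro brouwer_degree_eq_0[OF opB bdB ft]) auto
  finally show False using deg by simp
qed

section \<open>Concatenation of blocks\<close>

lemma flat_in_vecs: "flat n k x \<in> vecs ((k + 1) * n)"
  by (simp add: vecs_iff flat_def)

lemma block_index_less:
  fixes i j k n :: nat
  assumes "j \<le> k" "i < n"
  shows "j * n + i < (k + 1) * n"
proof -
  have "j * n + i < j * n + n" using assms by simp
  also have "\<dots> = (j + 1) * n" by simp
  also have "\<dots> \<le> (k + 1) * n" using assms by (intro mult_le_mono1) simp
  finally show ?thesis .
qed

lemma block_index_cases:
  fixes l k n :: nat
  assumes "l < (k + 1) * n"
  shows "l div n \<le> k" "l mod n < n"
proof -
  show "l div n \<le> k" using less_mult_imp_div_less[OF assms] by linarith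
  show "l mod n < n" using assms by (intro mod_less_divisor) (rule ccontr, simp)
qed

lemma flat_unflat:
  assumes "v \<in> vecs ((k + 1) * n)"
  shows "flat n k (unflat n k v) = v"
proof
  fix l
  show "flat n k (unflat n k v) l = v l"
    using assms block_index_cases[of l k n] by (auto simp: flat_def unflat_def vecs_iff not_less)
qed

lemma unflat_in_vec_tuples: "unflat n k v \<in> vec_tuples n k"
  by (auto simp: vec_tuples_def vecs_iff unflat_def)

lemma unflat_flat:
  assumes "x \<in> vec_tuples n k"
  shows "unflat n k (flat n k x) = x"
proof (intro ext)
  fix j i
  show "unflat n k (flat n k x) j i = x j i"
  proof (cases "j \<le> k \<and> i < n")
    case True
    then have "(j * n + i) div n = j" "(j * n + i) mod n = i" by auto
    with True show ?thesis
      by (simp only: flat_def unflat_def block_index_less if_True simp_thms)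
  next
    case False
    then have "unflat n k (flat n k x) j i = 0" by (simp only: unflat_def if_False)
    moreover have "x j i = 0"
      using False assms unfolding vec_tuples_def vecs_iff by (metis (mono_tags, lifting) mem_Collect_eq not_le)
    ultimately show ?thesis by simp
  qed
qed

lemma eucl_norm_flat_eq_0:
  "eucl_norm ((k + 1) * n) (flat n k x) = 0 \<longleftrightarrow> (\<forall>j\<le>k. \<forall>i<n. x j i = 0)"
proof
  assume L: "eucl_norm ((k + 1) * n) (flat n k x) = 0"
  show "\<forall>j\<le>k. \<forall>i<n. x j i = 0"
  proof (intro allI impI)
    fix j i assume "j \<le> k" "i < n"
    with L block_index_less[of j k i n] have "flat n k x (j * n + i) = 0"
      unfolding eucl_norm_eq_0 by blast
    then show "x j i = 0"
      using \<open>j \<le> k\<close> \<open>i < n\<close> block_index_less[of j k i n] by (simp add: flat_def)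
  qed
next
  assume "\<forall>j\<le>k. \<forall>i<n. x j i = 0"
  then show "eucl_norm ((k + 1) * n) (flat n k x) = 0"
    unfolding eucl_norm_eq_0 flat_def using block_index_cases by presburger
qed

lemma continuous_on_unflat:
  assumes "continuous_on S g"
  shows "continuous_on S (\<lambda>p. unflat n k (g p) j i)"
proof (cases "j \<le> k \<and> i < n")
  case True
  then show ?thesis
    by (simp add: unflat_def continuous_on_product_then_coordinatewise[OF assms])
next
  case False
  then have "unflat n k (g p) j i = 0" for p by (auto simp: unflat_def)
  then show ?thesis by simp
qed

section \<open>Coercivity of the residual of an EHR0 tensor\<close>

lemma continuous_on_prod_list:
  fixes g :: "'a::topological_space \<Rightarrow> 'b \<Rightarrow> real"
  assumes "\<And>i. continuous_on S (\<lambda>p. g p i)"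
  shows "continuous_on S (\<lambda>p. prod_list (map (g p) xs))"
proof (induction xs)
  case (Cons i xs)
  then show ?case by (simp add: continuous_on_mult assms)
qed simp

lemma continuous_on_tensor_app:
  assumes "\<And>i. continuous_on S (\<lambda>p. g p i)"
  shows "continuous_on S (\<lambda>p. tensor_app m n T (g p) i)"
proof (cases "i < n")
  case True
  have "continuous_on S (\<lambda>p. \<Sum>is\<in>index_lists (m - 1) n. T (i # is) * prod_list (map (g p) is))"
    by (intro continuous_on_sum continuous_on_mult continuous_on_const continuous_on_prod_list assms)
  with True show ?thesis by (simp add: tensor_app_def)
qed (simp add: tensor_app_def)

lemma prod_list_scale:
  "prod_list (map (\<lambda>i. c * x i) xs) = c ^ length xs * prod_list (map x xs)" for c :: real
  by (induction xs) auto

lemma tensor_app_scale: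
  "tensor_app m n T (\<lambda>i. c * x i) i = c ^ (m - 1) * tensor_app m n T x i"
proof -
  have "T (i # is) * prod_list (map (\<lambda>i. c * x i) is)
      = c ^ (m - 1) * (T (i # is) * prod_list (map x is))" if "is \<in> index_lists (m - 1) n" for "is"
    using that by (simp add: prod_list_scale index_lists_def)
  then have "(\<Sum>is\<in>index_lists (m - 1) n. T (i # is) * prod_list (map (\<lambda>i. c * x i) is))
      = (\<Sum>is\<in>index_lists (m - 1) n. c ^ (m - 1) * (T (i # is) * prod_list (map x is)))"
    by (rule sum.cong[OF refl])
  then have "(\<Sum>is\<in>index_lists (m - 1) n. T (i # is) * prod_list (map (\<lambda>i. c * x i) is))
      = c ^ (m - 1) * (\<Sum>is\<in>index_lists (m - 1) n. T (i # is) * prod_list (map x is))"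
    by (simp only: sum_distrib_left)
  then show ?thesis
    by (cases "i < n") (simp_all only: tensor_app_def if_True if_False mult_zero_right)
qed

definition residual ::
  "nat \<Rightarrow> nat \<Rightarrow> nat \<Rightarrow> (nat \<Rightarrow> nat list \<Rightarrow> real) \<Rightarrow> (nat \<Rightarrow> nat \<Rightarrow> real) \<Rightarrow> nat \<Rightarrow> real" where
  "residual m n k A x =
     (\<lambda>i. tensor_app m n (A 0) (x 0) i - (\<Sum>j=1..k. tensor_app m n (A j) (x j) i))"

lemma continuous_on_residual:
  assumes "\<And>j i. continuous_on S (\<lambda>p. g p j i)"
  shows "continuous_on S (\<lambda>p. residual m n k A (g p) i)"
  unfolding residual_def by (intro continuous_intros continuous_on_tensor_app assms)

lemma residual_scale:
  "residual m n k A (\<lambda>j i. c * x j i) i = c ^ (m - 1) * residual m n k A x i"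
  by (simp add: residual_def tensor_app_scale sum_distrib_left right_diff_distrib)

definition complementary :: "nat \<Rightarrow> nat \<Rightarrow> (nat \<Rightarrow> nat \<Rightarrow> real) \<Rightarrow> bool" where
  "complementary n k x \<longleftrightarrow> (\<forall>j\<in>{1..k}. \<forall>i<n. min (x 0 i) (x j i) = 0)"

lemma EHR0_zero:
  assumes "EHR0 m n k A" "x \<in> vec_tuples n k" "complementary n k x"
    and "\<And>i. i < n \<Longrightarrow> residual m n k A x i = 0"
  shows "x = (\<lambda>_ _. 0)"
proof -
  have "tensor_app m n (A 0) (x 0) i = (\<Sum>j=1..k. tensor_app m n (A j) (x j) i)" for i
    using assms(4)[of i] by (cases "i < n") (auto simp: residual_def tensor_app_def)
  moreover have "wedge (x 0) (x j) = (\<lambda>_. 0)" if "j \<in> {1..k}" for j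
  proof
    fix i
    have "x 0 i = 0 \<and> x j i = 0" if "\<not> i < n"
      using that \<open>j \<in> {1..k}\<close> assms(2) by (auto simp: vec_tuples_def vecs_iff)
    then show "wedge (x 0) (x j) i = 0"
      using assms(3) that by (cases "i < n") (auto simp: wedge_def complementary_def)
  qed
  ultimately show ?thesis
    using assms(1,2) unfolding EHR0_def by blast
qed

text \<open>
  On the unit vectors with \<^const>\<open>complementary\<close> blocks, which form a compact set, the norm of
  the residual is continuous and positive, hence at least some \<open>c > 0\<close>.  Complementarity is
  preserved by positive scaling and the residual is homogeneous of degree \<open>m - 1\<close>, so the bound
  extends to all vectors.
\<close>

lemma EHR0_coercive:
  assumes E: "EHR0 m n k A" and m: "2 \<le> m"
  obtains c where "0 < c"
    "\<And>v. v \<in> vecs ((k + 1) * n) \<Longrightarrow> complementary n k (unflat n k v) \<Longrightarrow>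
       c * eucl_norm ((k + 1) * n) v ^ (m - 1) \<le> eucl_norm n (residual m n k A (unflat n k v))"
proof -
  define N where "N = (k + 1) * n"
  define W where "W = {v. eucl_norm N v = 1 \<and> complementary n k (unflat n k v)}"
  define K where "K = {v \<in> vecs N. eucl_norm N v \<le> 1} \<inter> W"
  define g where "g v = eucl_norm n (residual m n k A (unflat n k v))" for v
  have un: "continuous_on UNIV (\<lambda>v. unflat n k v j i)" for j i
    by (intro continuous_on_unflat continuous_on_id)
  have "closed W"
  proof -
    have "W = {v. eucl_norm N v = 1} \<inter>
        (\<Inter>j\<in>{1..k}. \<Inter>i\<in>{..<n}. {v. min (unflat n k v 0 i) (unflat n k v j i) = 0})"
      unfolding W_def complementary_def by blast
    moreover have "closed {v. eucl_norm N v = 1}"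
      by (intro closed_Collect_eq continuous_on_eucl_norm continuous_on_id continuous_on_const)
    moreover have "closed (\<Inter>j\<in>{1..k}. \<Inter>i\<in>{..<n}. {v. min (unflat n k v 0 i) (unflat n k v j i) = 0})"
    proof (rule closed_INT, rule ballI, rule closed_INT, rule ballI)
      show "closed {v. min (unflat n k v 0 i) (unflat n k v j i) = 0}" for i j
        by (intro closed_Collect_eq continuous_on_min un continuous_on_const)
    qed
    ultimately show ?thesis by (simp only: closed_Int)
  qed
  then have "compact K"
    unfolding K_def by (intro compact_Int_closed compact_eucl_norm_le)
  moreover have "continuous_on K g"
    unfolding g_def
    by (rule continuous_on_subset[of UNIV])
      (auto intro!: continuous_on_eucl_norm continuous_on_coordinatewise_then_product continuous_on_residual un)
  moreover have "0 < g v" if v: "v \<in> K" for v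
  proof (rule ccontr)
    assume "\<not> 0 < g v"
    then have "g v = 0" using eucl_norm_nonneg[of n "residual m n k A (unflat n k v)"] by (simp add: g_def)
    then have "unflat n k v = (\<lambda>_ _. 0)"
      using v by (intro EHR0_zero[OF E]) (auto simp: K_def W_def g_def eucl_norm_eq_0 unflat_in_vec_tuples)
    then have "eucl_norm N (flat n k (unflat n k v)) = 0"
      unfolding N_def eucl_norm_flat_eq_0 by simp
    then show False using v by (simp add: K_def W_def N_def flat_unflat)
  qed
  ultimately obtain c where c: "0 < c" "\<And>v. v \<in> K \<Longrightarrow> c \<le> g v"
    using pos_lower_bound_on_compact by blast
  show thesis
  proof (rule that[OF c(1)], fold N_def)
    fix v assume v: "v \<in> vecs N" "complementary n k (unflat n k v)"
    define s where "s = eucl_norm N v"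
    show "c * s ^ (m - 1) \<le> eucl_norm n (residual m n k A (unflat n k v))"
    proof (cases "s = 0")
      \<comment> \<open>Here \<open>m \<ge> 2\<close> matters: for \<open>m = 1\<close> the power $0^0$ would be 1.\<close>
      case True
      then show ?thesis using m eucl_norm_nonneg by (simp add: power_0_left)
    next
      case False
      then have s: "0 < s" using eucl_norm_nonneg[of N v] by (simp add: s_def)
      define w where "w = (\<lambda>i. (1 / s) * v i)"
      have uw: "unflat n k w = (\<lambda>j i. (1 / s) * unflat n k v j i)"
        by (auto simp: unflat_def w_def fun_eq_iff)
      have "eucl_norm N w = 1"
        unfolding w_def eucl_norm_scale using s by (simp add: s_def[symmetric])
      moreover have "complementary n k (unflat n k w)"
        unfolding complementary_def uw
      proof (intro ballI allI impI)
        fix j i assume "j \<in> {1..k}" "i < n"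
        then have "min (unflat n k v 0 i) (unflat n k v j i) = 0"
          using v(2) by (simp add: complementary_def)
        then show "min (1 / s * unflat n k v 0 i) (1 / s * unflat n k v j i) = 0"
          using s by (auto simp: min_def zero_le_divide_iff divide_le_0_iff split: if_splits)
      qed
      ultimately have "w \<in> K" using v(1) by (auto simp: K_def W_def w_def vecs_iff)
      then have "c \<le> g w" by (rule c(2))
      also have "g w = eucl_norm n (\<lambda>i. (1 / s) ^ (m - 1) * residual m n k A (unflat n k v) i)"
        unfolding g_def uw residual_scale by (simp add: residual_scale[abs_def])
      also have "\<dots> = (1 / s) ^ (m - 1) * eucl_norm n (residual m n k A (unflat n k v))"
        unfolding eucl_norm_scale using s by simp
      finally show ?thesis using s by (simp add: power_divide field_simps)
    qed
  qed
qed

section \<open>The homotopy from Psi to the complementarity problem\<close>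

text \<open>
  The arguments of the minimum in block \<open>j\<close> interpolate between those in \<^const>\<open>Psi\<close> and those in
  \<^const>\<open>SOL\<close>; the convex combination is formed inside the minimum, so that every stage is
  again a complementarity system.
\<close>

definition homotopy ::
  "nat \<Rightarrow> nat \<Rightarrow> nat \<Rightarrow> (nat \<Rightarrow> nat list \<Rightarrow> real) \<Rightarrow> (nat \<Rightarrow> nat \<Rightarrow> real) \<Rightarrow> (nat \<Rightarrow> real)
     \<Rightarrow> real \<Rightarrow> (nat \<Rightarrow> nat \<Rightarrow> real) \<Rightarrow> nat \<Rightarrow> nat \<Rightarrow> real" where
  "homotopy m n k A d q t x =
     (\<lambda>j. if j = 0 then wedge (x 0) (x 1)
          else if j < k then wedge (\<lambda>i. (1 - t) * x 0 i + t * (d j i - x j i)) (x (j + 1))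
          else if j = k then (\<lambda>i. residual m n k A x i - t * q i)
          else (\<lambda>_. 0))"

lemma homotopy_0:
  assumes "1 \<le> k"
  shows "homotopy m n k A d q 0 x = Psi m n k A x"
  using assms by (auto simp: homotopy_def Psi_def residual_def fun_eq_iff)

text \<open>
  One coordinate of a zero of the homotopy: \<open>a\<close> and \<open>b j\<close> are the entries of $x_0$ and $x_j$, and
  \<open>e j\<close> is that of $d_j$.  If \<open>a > 0\<close>, then \<open>b j = 0\<close> makes the first argument of the next
  minimum equal to \<open>(1 - t) * a + t * e j > 0\<close>, which forces \<open>b (j + 1) = 0\<close>.
\<close>

lemma complementarity_chain:
  fixes a t :: real and b e :: "nat \<Rightarrow> real" and j k :: nat
  assumes "min a (b 1) = 0" and t: "0 \<le> t" "t \<le> 1"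
    and "\<And>j. j \<in> {1..k-1} \<Longrightarrow> min ((1 - t) * a + t * (e j - b j)) (b (j + 1)) = 0"
    and "\<And>j. j \<in> {1..k-1} \<Longrightarrow> 0 < e j"
    and j: "1 \<le> j" "j \<le> k"
  shows "min a (b j) = 0"
  using j
proof (induction j rule: dec_induct)
  case base
  then show ?case using assms(1) by simp
next
  case (step j)
  then have IH: "min a (b j) = 0" and j: "j \<in> {1..k-1}" by auto
  note z = assms(4)[OF j]
  show ?case
  proof (cases "a = 0")
    case True
    with z show ?thesis by (auto simp: min_def split: if_splits)
  next
    case False
    with IH have a: "0 < a" "b j = 0" by (auto simp: min_def split: if_splits)
    have "0 < (1 - t) * a + t * e j"
    proof (cases "t = 0")
      case False
      then have "0 < t * e j" using t assms(5)[OF j] by simp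
      then show ?thesis using a t by (simp add: add_nonneg_pos)
    qed (use a in simp)
    with z a show ?thesis by (auto simp: min_def split: if_splits)
  qed
qed

lemma homotopy_zero:
  assumes k: "1 \<le> k" and t: "t \<in> {0..1}" and d: "\<And>j i. j \<in> {1..k-1} \<Longrightarrow> i < n \<Longrightarrow> 0 < d j i"
    and z: "\<forall>j\<le>k. \<forall>i<n. homotopy m n k A d q t x j i = 0"
  shows "complementary n k x" "\<And>i. i < n \<Longrightarrow> residual m n k A x i = t * q i"
proof -
  show "complementary n k x"
    unfolding complementary_def
  proof (intro ballI allI impI)
    fix j i assume j: "j \<in> {1..k}" and i: "i < n"
    show "min (x 0 i) (x j i) = 0"
    proof (rule complementarity_chain[where a = "x 0 i" and b = "\<lambda>j. x j i" and t = t
          and e = "\<lambda>j. d j i" and k = k])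
      show "min (x 0 i) (x 1 i) = 0"
        using z[rule_format, of 0 i] i by (simp add: homotopy_def wedge_def)
      fix l assume l: "l \<in> {1..k-1}"
      then have "l \<noteq> 0" "l < k" "l \<le> k" by auto
      then show "min ((1 - t) * x 0 i + t * (d l i - x l i)) (x (l + 1) i) = 0"
        using z[rule_format, of l i] i by (simp add: homotopy_def wedge_def)
      show "0 < d l i" using d l i by blast
    qed (use t j in auto)
  qed
  show "residual m n k A x i = t * q i" if "i < n" for i
    using z[rule_format, of k i] that k by (simp add: homotopy_def)
qed

lemma homotopy_1_zero_iff_SOL:
  assumes k: "1 \<le> k" and x: "x \<in> vec_tuples n k"
    and d: "\<And>j. j \<in> {1..k-1} \<Longrightarrow> d j \<in> vecs n" and q: "q \<in> vecs n"
  shows "(\<forall>j\<le>k. \<forall>i<n. homotopy m n k A d q 1 x j i = 0) \<longleftrightarrow> x \<in> SOL m n k A d q"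
proof
  assume z: "\<forall>j\<le>k. \<forall>i<n. homotopy m n k A d q 1 x j i = 0"
  have x0: "x j i = 0" if "\<not> i < n" for i j
    using x that by (cases "j \<le> k") (auto simp: vec_tuples_def vecs_iff)
  have "tensor_app m n (A 0) (x 0) i = q i + (\<Sum>j=1..k. tensor_app m n (A j) (x j) i)" for i
    using z[rule_format, of k i] k q
    by (cases "i < n") (auto simp: homotopy_def residual_def tensor_app_def vecs_iff)
  moreover have "wedge (x 0) (x 1) i = 0" for i
    using z[rule_format, of 0 i] x0[of i] by (cases "i < n") (auto simp: homotopy_def wedge_def)
  moreover have "wedge (\<lambda>i. d j i - x j i) (x (j + 1)) i = 0" if j: "j \<in> {1..k-1}" for i j
  proof (cases "i < n")
    case True
    have "j \<le> k" "j < k" "j \<noteq> 0" using j by auto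
    with True z[rule_format, of j i] show ?thesis by (simp add: homotopy_def)
  next
    case False
    with x0[of i] d[OF j] show ?thesis by (simp add: wedge_def vecs_iff)
  qed
  ultimately show "x \<in> SOL m n k A d q"
    using x by (auto simp: SOL_def fun_eq_iff)
next
  assume "x \<in> SOL m n k A d q"
  then have s: "tensor_app m n (A 0) (x 0) i = q i + (\<Sum>j=1..k. tensor_app m n (A j) (x j) i)"
    "wedge (x 0) (x 1) i = 0"
    "j \<in> {1..k-1} \<Longrightarrow> wedge (\<lambda>i. d j i - x j i) (x (j + 1)) i = 0" for i j
    by (auto simp: SOL_def fun_eq_iff)
  show "\<forall>j\<le>k. \<forall>i<n. homotopy m n k A d q 1 x j i = 0"
    using s by (auto simp: homotopy_def residual_def)
qed

lemma continuous_on_flat_homotopy: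
  "continuous_on S (\<lambda>p. flat n k (homotopy m n k A d q (fst p) (unflat n k (snd p))))"
proof (rule continuous_on_coordinatewise_then_product)
  fix l
  have un: "continuous_on S (\<lambda>p. unflat n k (snd p) j i)" for j i
    by (intro continuous_on_unflat continuous_on_snd continuous_on_id)
  have "continuous_on S (\<lambda>p. homotopy m n k A d q (fst p) (unflat n k (snd p)) j i)" for j i
  proof -
    consider "j = 0" | "0 < j" "j < k" | "0 < j" "j = k" | "0 < j" "j > k" by linarith
    then show ?thesis
      by cases (auto simp: homotopy_def wedge_def intro!: continuous_intros un continuous_on_residual)
  qed
  then show "continuous_on S (\<lambda>p. flat n k (homotopy m n k A d q (fst p) (unflat n k (snd p))) l)"
    by (cases "l < (k + 1) * n") (auto simp: flat_def)
qed

section \<open>Existence and compactness of solutions\<close>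

theorem theorem4p3:
  fixes m n k :: nat
    and A :: "nat \<Rightarrow> nat list \<Rightarrow> real"
    and \<Omega> :: "(nat \<Rightarrow> real) set"
  assumes "m \<ge> 2" and "n \<ge> 1" and "k \<ge> 1"
    and "\<forall>j\<le>k. A j \<in> tensors m n"
    and "EHR0 m n k A"
    and "openin (Euclidean_space ((k + 1) * n)) \<Omega>"
    and "eucl_bounded ((k + 1) * n) \<Omega>"
    and "(\<lambda>_. 0) \<in> \<Omega>"
    and "tensor_degree m n k A \<Omega> \<noteq> 0"
  shows "\<forall>d q. (\<forall>j\<in>{1..k-1}. d j \<in> pos_vecs n) \<longrightarrow> q \<in> vecs n \<longrightarrow>
           SOL m n k A d q \<noteq> {} \<and> compact (SOL m n k A d q)"
proof (intro allI impI)
  fix d :: "nat \<Rightarrow> nat \<Rightarrow> real" and q :: "nat \<Rightarrow> real"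
  assume d: "\<forall>j\<in>{1..k-1}. d j \<in> pos_vecs n" and q: "q \<in> vecs n"
  define N where "N = (k + 1) * n"
  define f where "f t v = flat n k (homotopy m n k A d q t (unflat n k v))" for t v
  have f_0_iff: "eucl_norm N (f t v) = 0 \<longleftrightarrow>
      (\<forall>j\<le>k. \<forall>i<n. homotopy m n k A d q t (unflat n k v) j i = 0)" for t v
    by (simp only: f_def N_def eucl_norm_flat_eq_0)
  have f_cont: "continuous_on S (\<lambda>p. f (fst p) (snd p))" for S
    unfolding f_def by (rule continuous_on_flat_homotopy)
  obtain c where c: "0 < c"
    "\<And>v. v \<in> vecs N \<Longrightarrow> complementary n k (unflat n k v) \<Longrightarrow>
       c * eucl_norm N v ^ (m - 1) \<le> eucl_norm n (residual m n k A (unflat n k v))"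
    using EHR0_coercive[OF assms(5,1)] unfolding N_def by blast
  have zero_bound: "c * eucl_norm N v ^ (m - 1) \<le> t * eucl_norm n q"
    if t: "t \<in> {0..1}" and v: "v \<in> vecs N" and z: "eucl_norm N (f t v) = 0" for t v
  proof -
    have dpos: "0 < d j i" if "j \<in> {1..k-1}" "i < n" for j i
      using d that by (auto simp: pos_vecs_def)
    note zero = homotopy_zero[OF assms(3) t dpos z[unfolded f_0_iff]]
    have "eucl_norm n (residual m n k A (unflat n k v)) = eucl_norm n (\<lambda>i. t * q i)"
      using zero(2) by (simp add: eucl_norm_def L2_set_def)
    also have "\<dots> = t * eucl_norm n q" unfolding eucl_norm_scale using t by simp
    finally show ?thesis using c(2)[OF v zero(1)] by simp
  qed
  \<comment> \<open>If $|v| > 1$, then $|v| \le |v|^{m-1} \le |q|/c$; the summand 1 makes the bound strict.\<close>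
  define R where "R = max 1 (eucl_norm n q / c) + 1"
  have bound: "eucl_norm N v < R"
    if t: "t \<in> {0..1}" and v: "v \<in> vecs N" and z: "eucl_norm N (f t v) = 0" for t v
  proof (cases "eucl_norm N v \<le> 1")
    case False
    then have "eucl_norm N v ^ 1 \<le> eucl_norm N v ^ (m - 1)"
      using assms(1) by (intro power_increasing) auto
    then have "c * eucl_norm N v \<le> c * eucl_norm N v ^ (m - 1)"
      using c(1) by simp
    also have "\<dots> \<le> t * eucl_norm n q" by (rule zero_bound[OF t v z])
    also have "\<dots> \<le> eucl_norm n q"
      using t eucl_norm_nonneg[of n q] by (simp add: mult_left_le_one_le)
    finally have "eucl_norm N v \<le> eucl_norm n q / c"
      using c(1) by (simp add: pos_le_divide_eq mult.commute)
    then show ?thesis by (simp add: R_def)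
  qed (simp add: R_def)
  \<comment> \<open>The solutions are the zeros of the final stage, written as block tuples.\<close>
  define Z where "Z = {v \<in> vecs N. eucl_norm N (f 1 v) = 0}"
  have SOL_eq: "SOL m n k A d q = unflat n k ` Z"
  proof -
    have iff: "(\<forall>j\<le>k. \<forall>i<n. homotopy m n k A d q 1 x j i = 0) \<longleftrightarrow> x \<in> SOL m n k A d q"
      if "x \<in> vec_tuples n k" for x
      using d by (intro homotopy_1_zero_iff_SOL assms(3) that q) (auto simp: pos_vecs_def)
    have "unflat n k v \<in> SOL m n k A d q" if "v \<in> Z" for v
      using that iff[OF unflat_in_vec_tuples] by (simp add: Z_def f_0_iff)
    moreover have "x \<in> unflat n k ` Z" if x: "x \<in> SOL m n k A d q" for x
    proof
      have xt: "x \<in> vec_tuples n k" using x by (simp add: SOL_def)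
      show "x = unflat n k (flat n k x)" by (simp add: unflat_flat[OF xt])
      show "flat n k x \<in> Z"
        using x iff[OF xt] flat_in_vecs unfolding Z_def f_0_iff by (simp add: unflat_flat[OF xt] N_def)
    qed
    ultimately show ?thesis by blast
  qed
  have "Z \<noteq> {}"
  proof -
    have "f 0 = (\<lambda>v. flat n k (Psi m n k A (unflat n k v)))"
      by (rule ext) (simp only: f_def homotopy_0[OF assms(3)])
    then have deg: "brouwer_degree N (f 0) \<Omega> (\<lambda>_. 0) \<noteq> 0"
      using assms(9) by (simp only: tensor_degree_def N_def not_False_eq_True)
    have "v \<in> \<Omega>" if v: "v \<in> vecs N" "eucl_norm N (f 0 v) = 0" for v
    proof -
      have "c * eucl_norm N v ^ (m - 1) \<le> 0" using zero_bound[of 0 v] v by simp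
      then have "eucl_norm N v = 0"
        using c(1) eucl_norm_nonneg[of N v] by (auto simp: mult_le_0_iff power_le_zero_eq)
      then have "v = (\<lambda>_. 0)"
        using v(1) by (auto simp: eucl_norm_eq_0 vecs_iff fun_eq_iff) (meson not_le)
      then show ?thesis using assms(8) by simp
    qed
    then obtain v where "v \<in> vecs N" "eucl_norm N (f 1 v) = 0"
      using brouwer_degree_nonzero_imp_zero[where f = f and R = R,
          OF assms(6,7)[folded N_def] f_cont _ _ deg] bound by blast
    then show ?thesis by (auto simp: Z_def)
  qed
  moreover have "compact Z"
  proof -
    have "continuous_on UNIV (f 1)"
      using continuous_on_compose2[OF f_cont[of UNIV], of UNIV "\<lambda>v. (1, v)"]
      by (simp add: continuous_on_Pair)
    then have "closed {v. eucl_norm N (f 1 v) = 0}"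
      by (intro closed_Collect_eq continuous_on_eucl_norm continuous_on_const)
    then have "compact ({v \<in> vecs N. eucl_norm N v \<le> R} \<inter> {v. eucl_norm N (f 1 v) = 0})"
      by (rule compact_Int_closed[OF compact_eucl_norm_le])
    moreover have "{v \<in> vecs N. eucl_norm N v \<le> R} \<inter> {v. eucl_norm N (f 1 v) = 0} = Z"
      using bound[of 1] by (force simp: Z_def)
    ultimately show ?thesis by simp
  qed
  moreover have "continuous_on Z (unflat n k)"
    by (intro continuous_on_coordinatewise_then_product continuous_on_unflat continuous_on_id)
  ultimately show "SOL m n k A d q \<noteq> {} \<and> compact (SOL m n k A d q)"
    unfolding SOL_eq by (simp add: compact_continuous_image)
qed

end
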